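(* Let $H=(u(x,y,z),v(x,y,z),h(x,y))$ be a polynomial map with $u,v\in\mathbf{K}[x,y,z]$, $h\in\mathbf{K}[x,y]$ and $\deg_z v(x,y,z)=1$. Assume that $H(0)=0$ and $\deg_z u\geq 2$. If $JH$ is nilpotent, then $u,v,h$ are linearly dependent over $\mathbf{K}$.
   Context: $\mathbf{K}$ is an algebraically closed field. $JH$ denotes the $3\times 3$ Jacobian matrix of $H$ with respect to $(x,y,z)$. $\deg_z f$ is the highest degree of $z$ in $f$.
   Formalization: The field K is additionally assumed to have characteristic 0; in every characteristic p > 0 the claim fails, e.g. for u = z^p, v = x^p z, h = x^p + y^p, where JH squared is 0 but u, v, h are linearly independent. *)

theory Defs
  imports
    "HOL-Computational_Algebra.Polynomial"
    "Jordan_Normal_Form.Matrix"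
begin

text \<open>
  \<^typ>\<open>'a poly poly poly\<close> represents K[x,y,z] as K[x][y][z]: the outermost
  indeterminate is z, the middle one y, the innermost one x. Hence the degree of such a polynomial
  is its degree in z (with the zero polynomial having degree 0, where the usual convention is
  minus infinity). The subring K[x,y] consists of the constants \<open>[:h:]\<close> with
  \<open>h :: 'a poly poly\<close>.
\<close>

type_synonym 'a poly3 = "'a poly poly poly"

definition const3 :: "'a::zero \<Rightarrow> 'a poly3" where
  "const3 a = [:[:[:a:]:]:]"

definition eval3 :: "'a::comm_semiring_1 poly3 \<Rightarrow> 'a \<Rightarrow> 'a \<Rightarrow> 'a \<Rightarrow> 'a" where
  "eval3 p a b c = poly (poly (poly p [:[:c:]:]) [:b:]) a"

definition deg_z :: "'a::zero poly3 \<Rightarrow> nat" where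
  "deg_z p = degree p"

definition d_x :: "'a::idom poly3 \<Rightarrow> 'a poly3" where
  "d_x p = map_poly (map_poly pderiv) p"

definition d_y :: "'a::idom poly3 \<Rightarrow> 'a poly3" where
  "d_y p = map_poly pderiv p"

definition d_z :: "'a::idom poly3 \<Rightarrow> 'a poly3" where
  "d_z p = pderiv p"

definition jacobian3 :: "'a::idom poly3 \<Rightarrow> 'a poly3 \<Rightarrow> 'a poly3 \<Rightarrow> 'a poly3 mat" where
  "jacobian3 f g h = mat_of_rows_list 3
     [[d_x f, d_y f, d_z f],
      [d_x g, d_y g, d_z g],
      [d_x h, d_y h, d_z h]]"

definition nilpotent_mat :: "'a::semiring_1 mat \<Rightarrow> bool" where
  "nilpotent_mat A \<longleftrightarrow> square_mat A \<and> (\<exists>k. A ^\<^sub>m k = 0\<^sub>m (dim_row A) (dim_row A))"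

definition lin_dep3 :: "'a::comm_semiring_1 poly3 \<Rightarrow> 'a poly3 \<Rightarrow> 'a poly3 \<Rightarrow> bool" where
  "lin_dep3 f g h \<longleftrightarrow>
     (\<exists>a b c. (a, b, c) \<noteq> (0, 0, 0) \<and> const3 a * f + const3 b * g + const3 c * h = 0)"

end

(* In fact h = 0. Since JH is nilpotent over a domain, its trace, the sum of its principal
   2-minors and its determinant vanish. Write v = a z + b and u = \<Sum> u_n z^n with a, b, u_n in
   K[x,y] and d = deg_z u. By the trace, u_n depends only on y for n >= 2. Comparing the top
   coefficients in z of the other two equations and assuming (h_x, h_y) \<noteq> 0 leads to a
   contradiction:
   - If a_x \<noteq> 0, then (h_x, h_y) is proportional to (a_x, a_y), and successively the gradients of
     u_(d-1), b and u_(d-2) in (x,y) are too; coefficient d-1 of the minor equation is then d u_d h_x.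
   - If a_x = 0 and a_y \<noteq> 0, the equations force (u_d)_y a = d u_d a_y, so deg_y u_d = d deg_y a,
     which is incompatible with the degrees in y of the minor equation.
   - If a_x = a_y = 0 and h_x = 0, then b_x = 0 and the minor equation reduces to a h_y = 0.
   - If a_x = a_y = 0 and h_x \<noteq> 0, the top coefficients express h_x and h_y through b_x, b_y and
     s = (u_(d-1))_y, and the coefficients at z^0 leave a^2 s^2 = 0. *)

theory Submission
  imports Defs "Jordan_Normal_Form.Determinant"
begin

section \<open>Trace, principal minors and determinant of a nilpotent 3x3 matrix\<close>

lemma det_3:
  fixes A :: "'r::comm_ring_1 mat"
  assumes "A \<in> carrier_mat 3 3"
  shows "det A = A $$ (0,0) * (A $$ (1,1) * A $$ (2,2) - A $$ (1,2) * A $$ (2,1))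
               - A $$ (0,1) * (A $$ (1,0) * A $$ (2,2) - A $$ (1,2) * A $$ (2,0))
               + A $$ (0,2) * (A $$ (1,0) * A $$ (2,1) - A $$ (1,1) * A $$ (2,0))"
proof -
  have det_2: "det B = B $$ (0,0) * B $$ (1,1) - B $$ (0,1) * B $$ (1,0)"
    if B: "B \<in> carrier_mat 2 2" for B :: "'r mat"
    using B by (subst laplace_expansion_row[OF B, of 0])
      (auto simp: cofactor_def det_single numeral_2_eq_2 mat_delete_def)
  show ?thesis
    using assms by (subst laplace_expansion_row[OF assms, of 0])
      (auto simp: cofactor_def numeral_3_eq_3 det_2 mat_delete_def numeral_2_eq_2 algebra_simps)
qed

text \<open>The witness \<open>N\<close> is the geometric sum of the powers
  \<open>M ^\<^sub>m j\<close> with j < k, which telescopes; it is a left inverse as soon as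
  \<open>M ^\<^sub>m k\<close> vanishes.\<close>

lemma one_minus_nilpotent_mat_inverse:
  fixes M :: "'r::comm_ring_1 mat"
  assumes M: "M \<in> carrier_mat n n"
  shows "\<exists>N \<in> carrier_mat n n. N * (1\<^sub>m n - M) = 1\<^sub>m n - M ^\<^sub>m k"
proof (induction k)
  case 0
  show ?case
    using M by (intro bexI[of _ "0\<^sub>m n n"]) auto
next
  case (Suc k)
  then obtain N where N: "N \<in> carrier_mat n n" "N * (1\<^sub>m n - M) = 1\<^sub>m n - M ^\<^sub>m k"
    by blast
  have P: "M ^\<^sub>m k \<in> carrier_mat n n"
    using M by simp
  have "(N + M ^\<^sub>m k) * (1\<^sub>m n - M) = N * (1\<^sub>m n - M) + M ^\<^sub>m k * (1\<^sub>m n - M)"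
    by (rule add_mult_distrib_mat[OF N(1) P]) (use M in auto)
  also have "M ^\<^sub>m k * (1\<^sub>m n - M) = M ^\<^sub>m k - M ^\<^sub>m k * M"
    using P M by (subst mult_minus_distrib_mat[OF P]) auto
  also have "N * (1\<^sub>m n - M) + (M ^\<^sub>m k - M ^\<^sub>m k * M) = 1\<^sub>m n - M ^\<^sub>m Suc k"
    unfolding N(2) using P M by (intro eq_matI) auto
  finally show ?case
    using N(1) P by (intro bexI[of _ "N + M ^\<^sub>m k"]) auto
qed

lemma nilpotent_mat_3:
  fixes A :: "'r::idom mat"
  assumes A: "A \<in> carrier_mat 3 3" and nil: "nilpotent_mat A"
  shows "A $$ (0,0) + A $$ (1,1) + A $$ (2,2) = 0"
    and "A $$ (0,0) * A $$ (1,1) - A $$ (0,1) * A $$ (1,0)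
       + A $$ (0,0) * A $$ (2,2) - A $$ (0,2) * A $$ (2,0)
       + A $$ (1,1) * A $$ (2,2) - A $$ (1,2) * A $$ (2,1) = 0"
    and "det A = 0"
proof -
  \<comment> \<open>\<open>1 - X A\<close> is invertible over the polynomial ring, so its determinant is a constant.\<close>
  define M where "M = [:0, 1:] \<cdot>\<^sub>m map_mat (\<lambda>c. [:c:]) A"
  have M: "M \<in> carrier_mat 3 3"
    using A by (simp add: M_def)
  obtain k where k: "A ^\<^sub>m k = 0\<^sub>m 3 3"
    using nil A unfolding nilpotent_mat_def by auto
  have "M ^\<^sub>m j = monom 1 j \<cdot>\<^sub>m map_mat (\<lambda>c. [:c:]) (A ^\<^sub>m j)" for j
  proof (induction j)
    case 0
    show ?case
      using A M by (intro eq_matI) (auto simp: monom_0 one_pCons)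
  next
    case (Suc j)
    have P: "A ^\<^sub>m j \<in> carrier_mat 3 3"
      using A by simp
    interpret lift: comm_ring_hom "\<lambda>c :: 'r. [:c:]"
      by unfold_locales (simp_all add: one_pCons)
    have hom: "map_mat (\<lambda>c. [:c:]) (A ^\<^sub>m j * A)
      = map_mat (\<lambda>c. [:c:]) (A ^\<^sub>m j) * map_mat (\<lambda>c. [:c:]) A"
      by (rule lift.mat_hom_mult[OF P A])
    have "monom 1 (Suc j) = monom 1 j * [:0, 1 :: 'r:]"
      by (simp add: monom_Suc)
    then show ?case
      using A P unfolding pow_mat.simps Suc hom unfolding M_def
      by (simp add: mult_smult_distrib[of _ 3 3 _ 3] mult_smult_assoc_mat[of _ 3 3 _ 3])
        (intro eq_matI, auto simp: ac_simps)
  qed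
  then have "M ^\<^sub>m k = 0\<^sub>m 3 3"
    using k by (intro eq_matI) auto
  then have "1\<^sub>m 3 - M ^\<^sub>m k = 1\<^sub>m 3"
    by (intro eq_matI) auto
  then obtain N where N: "N \<in> carrier_mat 3 3" "N * (1\<^sub>m 3 - M) = 1\<^sub>m 3"
    using one_minus_nilpotent_mat_inverse[OF M, of k] by auto
  have C: "1\<^sub>m 3 - M \<in> carrier_mat 3 3"
    using M by (rule minus_carrier_mat)
  have "det N * det (1\<^sub>m 3 - M) = 1"
    using det_mult[OF N(1) C] N(2) by simp
  then have "det (1\<^sub>m 3 - M) dvd 1"
    by (metis dvd_triv_right)
  then obtain c where c: "det (1\<^sub>m 3 - M) = [:c:]"
    by (auto simp: is_unit_poly_iff)
  have entry: "(1\<^sub>m 3 - M) $$ (i, j) = [:if i = j then 1 else 0, - A $$ (i, j):]"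
    if "i < 3" "j < 3" for i j
    using that A by (auto simp: M_def one_pCons)
  have "det (1\<^sub>m 3 - M) = [:1, - (A $$ (0,0) + A $$ (1,1) + A $$ (2,2)),
      A $$ (0,0) * A $$ (1,1) - A $$ (0,1) * A $$ (1,0)
      + A $$ (0,0) * A $$ (2,2) - A $$ (0,2) * A $$ (2,0)
      + A $$ (1,1) * A $$ (2,2) - A $$ (1,2) * A $$ (2,1), - det A:]"
    unfolding det_3[OF C] det_3[OF A] by (simp add: entry algebra_simps)
  from this[symmetric]
  show "A $$ (0,0) + A $$ (1,1) + A $$ (2,2) = 0"
    and "A $$ (0,0) * A $$ (1,1) - A $$ (0,1) * A $$ (1,0)
       + A $$ (0,0) * A $$ (2,2) - A $$ (0,2) * A $$ (2,0)
       + A $$ (1,1) * A $$ (2,2) - A $$ (1,2) * A $$ (2,1) = 0"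
    and "det A = 0"
    using c by (simp_all only: pCons_eq_iff pCons_eq_0_iff neg_equal_0_iff_equal)
qed

text \<open>The first hypothesis says that \<open>w\<close> and \<open>a ^ d\<close> have the same
  logarithmic derivative. Comparing the top coefficients of both sides and cancelling the leading
  coefficients gives the degrees, by characteristic 0.\<close>

lemma degree_eq_of_log_pderiv_eq:
  fixes a w :: "'s::{idom, ring_char_0} poly"
  assumes "pderiv w * a = of_nat d * w * pderiv a" and "pderiv w \<noteq> 0" "pderiv a \<noteq> 0"
  shows "degree w = d * degree a"
proof -
  have a: "degree a > 0" and w: "degree w > 0"
    using assms(2,3) by (auto simp: pderiv_eq_0_iff)
  have lead: "coeff (pderiv p * q) (degree p - 1 + degree q)
      = of_nat (degree p) * lead_coeff p * lead_coeff q"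
    if "degree p > 0" for p q :: "'s poly"
    using that coeff_mult_degree_sum[of "pderiv p" q]
    by (simp add: degree_pderiv coeff_pderiv)
  have deg: "degree w - 1 + degree a = degree a - 1 + degree w"
    using a w by simp
  have eq: "pderiv w * a = Polynomial.smult (of_nat d) (pderiv a * w)"
    using assms(1) by (simp add: of_nat_poly mult_ac)
  have "of_nat (degree w) * lead_coeff w * lead_coeff a
      = of_nat d * (of_nat (degree a) * lead_coeff a * lead_coeff w)"
    using arg_cong[OF eq, of "\<lambda>p. coeff p (degree w - 1 + degree a)"]
    unfolding coeff_smult lead[OF w] unfolding deg lead[OF a] .
  moreover have "lead_coeff w \<noteq> 0" "lead_coeff a \<noteq> 0"
    using a w by auto
  ultimately have "of_nat (degree w) = (of_nat (d * degree a) :: 's)"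
    by (simp add: mult_ac)
  then show ?thesis
    by (simp only: of_nat_eq_iff)
qed

section \<open>The system of coefficient equations in z\<close>

text \<open>
  The coefficients in z of the trace, minor and determinant equations. Here \<open>pderiv\<close> is the
  derivative in y, while \<open>X n\<close>, \<open>ax\<close>, \<open>bx\<close> stand for the derivatives in x of \<open>U n\<close>, \<open>a\<close>, \<open>b\<close>, and
  \<open>hx\<close>, \<open>hy\<close> for the partial derivatives of h; no relation between x-derivatives and their
  primitives is needed.
\<close>

locale reduced_system =
  fixes U X :: "nat \<Rightarrow> 's::{idom, ring_char_0} poly" and a b ax bx hx hy :: "'s poly" and d :: nat
  assumes d: "d \<ge> 2" and Ud: "U d \<noteq> 0" and U_high: "\<And>n. n > d \<Longrightarrow> U n = 0"
    and a: "a \<noteq> 0"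
    and X0: "X 0 = - pderiv b" and X1: "X 1 = - pderiv a" and X2: "\<And>n. n \<ge> 2 \<Longrightarrow> X n = 0"
    and minor0: "X 0 * pderiv b - pderiv (U 0) * bx - U 1 * hx - a * hy = 0"
    and minor: "\<And>n. X (Suc n) * pderiv b + X n * pderiv a - pderiv (U (Suc n)) * bx
        - pderiv (U n) * ax - of_nat (Suc (Suc n)) * U (Suc (Suc n)) * hx = 0"
    and det: "\<And>n. hx * (pderiv (U n) * a - of_nat (Suc n) * U (Suc n) * pderiv b
          - of_nat n * U n * pderiv a)
        - hy * (X n * a - of_nat (Suc n) * U (Suc n) * bx - of_nat n * U n * ax) = 0"
begin

lemma gradient_zero_if_ax_nonzero:
  assumes ax: "ax \<noteq> 0"
  shows "hx = 0 \<and> hy = 0"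
proof (rule ccontr)
  assume h: "\<not> (hx = 0 \<and> hy = 0)"
  obtain e where e: "d = Suc (Suc e)"
    using that[of "d - 2"] d by simp
  define c where "c = of_nat d * U d"
  have c: "c \<noteq> 0"
    using Ud d by (auto simp: c_def)
  \<comment> \<open>At index d only the term \<open>pderiv (U d) * ax\<close> survives.\<close>
  have Ud': "pderiv (U d) = 0"
    using minor[of d] ax d by (simp add: X2 U_high)
  have "c * (hx * pderiv a - hy * ax) = 0"
    using det[of d] d unfolding c_def by (auto simp: X2 U_high Ud' algebra_simps)
  then have par: "hx * pderiv a - hy * ax = 0"
    using c by simp
  then have hx: "hx \<noteq> 0"
    using h ax by auto
  have minor_d: "ax * pderiv (U (Suc e)) - pderiv a * X (Suc e) = 0"
    using minor[of "Suc e"] d by (simp add: e[symmetric] X2 U_high Ud' mult_ac)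
  \<comment> \<open>Multiplying \<open>det\<close> by \<open>ax\<close> and removing
    \<open>hy\<close> through \<open>par\<close> expresses the Jacobian determinant of (a, U n) by
    that of (a, b).\<close>
  have D: "a * (ax * pderiv (U n) - pderiv a * X n)
      = of_nat (Suc n) * U (Suc n) * (ax * pderiv b - pderiv a * bx)" for n
  proof -
    have "hx * (a * (ax * pderiv (U n) - pderiv a * X n)
      - of_nat (Suc n) * U (Suc n) * (ax * pderiv b - pderiv a * bx))
      = ax * (hx * (pderiv (U n) * a - of_nat (Suc n) * U (Suc n) * pderiv b
          - of_nat n * U n * pderiv a)
        - hy * (X n * a - of_nat (Suc n) * U (Suc n) * bx - of_nat n * U n * ax))
      - (hx * pderiv a - hy * ax)
        * (X n * a - of_nat (Suc n) * U (Suc n) * bx - of_nat n * U n * ax)"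
      by (simp add: algebra_simps)
    also have "\<dots> = 0"
      unfolding det par by simp
    finally have "hx * (a * (ax * pderiv (U n) - pderiv a * X n)
      - of_nat (Suc n) * U (Suc n) * (ax * pderiv b - pderiv a * bx)) = 0" .
    then show ?thesis
      using hx by simp
  qed
  have "c * (ax * pderiv b - pderiv a * bx) = 0"
    using D[of "Suc e"] unfolding e[symmetric] c_def minor_d by simp
  then have w: "ax * pderiv b - pderiv a * bx = 0"
    using c by simp
  have "a * (ax * pderiv (U e) - pderiv a * X e) = 0"
    using D[of e] unfolding w by simp
  then have De: "ax * pderiv (U e) - pderiv a * X e = 0"
    using a by simp
  have minor_e: "X (Suc e) * pderiv b + X e * pderiv a - pderiv (U (Suc e)) * bx
        - pderiv (U e) * ax - c * hx = 0"
    using minor[of e] unfolding e[symmetric] c_def .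
  \<comment> \<open>After multiplication by \<open>ax\<close>, all other terms of
    \<open>minor_e\<close> combine into Jacobian determinants with \<open>a\<close>, already known
    to vanish.\<close>
  have "ax * (c * hx) = X (Suc e) * (ax * pderiv b - pderiv a * bx)
      - bx * (ax * pderiv (U (Suc e)) - pderiv a * X (Suc e))
      - ax * (ax * pderiv (U e) - pderiv a * X e)
      - ax * (X (Suc e) * pderiv b + X e * pderiv a - pderiv (U (Suc e)) * bx
        - pderiv (U e) * ax - c * hx)"
    by (simp add: algebra_simps)
  also have "\<dots> = 0"
    unfolding w minor_d De minor_e by simp
  finally show False
    using ax c hx by simp
qed

lemma hy_zero_if_ax_hx_zero:
  assumes ax: "ax = 0" and hx: "hx = 0"
  shows "hy = 0"
proof (rule ccontr)
  assume hy: "hy \<noteq> 0"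
  have D: "X n * a = of_nat (Suc n) * U (Suc n) * bx" for n
    using det[of n] hy ax hx by simp
  have bx: "bx \<noteq> 0"
  proof
    assume bx: "bx = 0"
    then have "X 0 = 0"
      using D[of 0] a by simp
    then show False
      using minor0 bx hx a hy by simp
  qed
  obtain e where e: "d = Suc (Suc e)"
    using that[of "d - 2"] d by simp
  \<comment> \<open>The index here is d - 1; as \<open>X\<close> vanishes from index 2 on, d - 1 is
    at most 1.\<close>
  have "X (Suc e) * a \<noteq> 0"
    using D[of "Suc e"] bx Ud by (simp add: e del: of_nat_Suc)
  then have d2: "d = 2"
    using X2[of "Suc e"] e by (cases e) auto
  have 1: "- pderiv a * a = 2 * U 2 * bx"
    using D[of 1] X1 by (simp add: numeral_2_eq_2)
  have 2: "- pderiv a * pderiv a = pderiv (U 2) * bx"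
    using minor[of 1] X1 X2[of 2] ax hx by (simp add: numeral_2_eq_2)
  have a': "pderiv a \<noteq> 0"
    using 1 bx Ud d2 by auto
  then have U': "pderiv (U 2) \<noteq> 0"
    using 2 by auto
  \<comment> \<open>This combination eliminates \<open>bx\<close> from the two equations.\<close>
  have "pderiv a * (pderiv (U 2) * a - 2 * U 2 * pderiv a)
      = 2 * U 2 * (- pderiv a * pderiv a) - pderiv (U 2) * (- pderiv a * a)"
    by (simp add: algebra_simps)
  also have "\<dots> = 0"
    unfolding 1 2 by simp
  finally have "pderiv (U 2) * a = of_nat 2 * U 2 * pderiv a"
    using a' by simp
  then have "degree (U 2) = 2 * degree a"
    by (rule degree_eq_of_log_pderiv_eq) (use U' a' in auto)
  \<comment> \<open>Parity of degrees: with deg U_2 = 2 deg a, the right side is at least 2 deg a -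
    1, the left side 2 deg a - 2.\<close>
  moreover have "2 * (degree a - 1) = degree (U 2) - 1 + degree bx"
    using arg_cong[OF 2, of degree] a' U' bx
    by (simp add: degree_mult_eq degree_pderiv)
  moreover have "degree a > 0"
    using a' by (auto simp: pderiv_eq_0_iff)
  ultimately show False
    by simp
qed

lemma hx_zero_if_ax_zero:
  assumes ax: "ax = 0"
  shows "hx = 0"
proof (rule ccontr)
  assume hx: "hx \<noteq> 0"
  obtain e where e: "d = Suc (Suc e)"
    using that[of "d - 2"] d by simp
  define c where "c = of_nat d * U d"
  have c: "c \<noteq> 0"
    using Ud d by (auto simp: c_def)
  \<comment> \<open>At n = d the factor of \<open>hy\<close> in \<open>det\<close> is zero, so
    \<open>hx\<close> can be cancelled.\<close>
  have rel: "pderiv (U d) * a = of_nat d * U d * pderiv a"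
    using det[of d] ax d hx by (simp add: X2 U_high)
  have minor_e: "X (Suc e) * pderiv b + X e * pderiv a - pderiv (U (Suc e)) * bx = c * hx"
    using minor[of e] ax unfolding e[symmetric] c_def by simp
  show False
  proof (cases "pderiv a = 0")
    case False
    have U': "pderiv (U d) \<noteq> 0"
      using rel False Ud d by auto
    have degU: "degree (U d) = d * degree a"
      by (rule degree_eq_of_log_pderiv_eq[OF rel U' False])
    have dega: "degree a > 0"
      using False by (auto simp: pderiv_eq_0_iff)
    have minor_d: "X (Suc e) * pderiv a = pderiv (U d) * bx"
      using minor[of "Suc e"] ax d by (simp add: e[symmetric] X2 U_high)
    show False
    proof (cases e)
      case 0
      then have 2: "- pderiv a * pderiv a = pderiv (U d) * bx"
        using minor_d X1 by simp
      then have "bx \<noteq> 0"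
        using False by auto
      then have "2 * (degree a - 1) = degree (U d) - 1 + degree bx"
        using arg_cong[OF 2, of degree] False U'
        by (simp add: degree_mult_eq degree_pderiv)
      then show False
        using degU dega e 0 by simp
    next
      case (Suc e')
      then have bx: "bx = 0"
        using minor_d U' X2[of "Suc e"] by simp
      \<comment> \<open>The right side is nonzero, so \<open>X e\<close> is too and e = 1. Then d =
        3, and the degree 3 deg a of \<open>U d\<close> exceeds the 2 deg a - 2 on the left.\<close>
      have "X e * pderiv a = c * hx"
        using minor_e bx Suc X2[of "Suc e"] by simp
      moreover from this have "e = 1"
        using c hx X2[of e] Suc by (cases e') auto
      ultimately have 3: "- pderiv a * pderiv a = Polynomial.smult (of_nat d) (U d * hx)"
        using X1 by (simp add: c_def of_nat_poly)
      have "2 * (degree a - 1) = degree (U d) + degree hx"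
        using arg_cong[OF 3, of degree] False Ud hx d
        by (simp add: degree_mult_eq degree_pderiv)
      then show False
        using degU dega \<open>e = 1\<close> e by simp
    qed
  next
    case True
    define s where "s = pderiv (U (Suc e))"
    have X: "X n = 0" if "n \<ge> 1" for n
      using X1 X2 True that by (cases "n = 1") auto
    have hx': "c * hx + s * bx = 0"
      using minor_e[symmetric] True X by (simp add: s_def)
    have "s \<noteq> 0"
      using hx' c hx by auto
    have bx: "bx \<noteq> 0"
      using hx' c hx by auto
    have det_e: "hx * (s * a - c * pderiv b) + hy * (c * bx) = 0"
      using det[of "Suc e"] ax True X unfolding e[symmetric] c_def s_def by simp
    \<comment> \<open>Eliminating \<open>hx\<close> leaves a multiple of \<open>bx\<close>; after
      cancellation \<open>hy\<close> is expressed through \<open>s\<close> and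
      \<open>pderiv b\<close>.\<close>
    have "bx * (c * c * hy - s * s * a + c * s * pderiv b)
        = c * (hx * (s * a - c * pderiv b) + hy * (c * bx))
          - (s * a - c * pderiv b) * (c * hx + s * bx)"
      by (simp add: algebra_simps)
    also have "\<dots> = 0"
      unfolding det_e hx' by simp
    finally have hy': "c * c * hy - s * s * a + c * s * pderiv b = 0"
      using bx by simp
    have det0: "hx * (pderiv (U 0) * a - U 1 * pderiv b) + hy * (pderiv b * a + U 1 * bx) = 0"
      using det[of 0] X0 ax True by (simp add: algebra_simps)
    \<comment> \<open>Inserting the expressions for \<open>hx\<close> and \<open>hy\<close> into c^2
      times \<open>det0\<close> leaves a multiple of \<open>s * a\<close>.\<close>
    have "s * a * (c * pderiv (U 0) * bx - U 1 * s * bx + pderiv b * (c * pderiv b - s * a))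
        = c * (c * hx + s * bx) * (pderiv (U 0) * a - U 1 * pderiv b)
          + (c * c * hy - s * s * a + c * s * pderiv b) * (pderiv b * a + U 1 * bx)
          - c * c * (hx * (pderiv (U 0) * a - U 1 * pderiv b) + hy * (pderiv b * a + U 1 * bx))"
      by (simp add: algebra_simps)
    also have "\<dots> = 0"
      unfolding det0 hx' hy' by simp
    finally have 1: "c * pderiv (U 0) * bx - U 1 * s * bx + pderiv b * (c * pderiv b - s * a) = 0"
      using \<open>s \<noteq> 0\<close> a by simp
    have 2: "- (pderiv b * pderiv b) - pderiv (U 0) * bx - U 1 * hx - a * hy = 0"
      using minor0 X0 by simp
    \<comment> \<open>The same substitution in c^2 times \<open>minor0\<close>, with equation 1
      removing \<open>pderiv (U 0)\<close>.\<close>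
    have "a * a * s * s
        = - (c * c * (- (pderiv b * pderiv b) - pderiv (U 0) * bx - U 1 * hx - a * hy))
          - c * (c * pderiv (U 0) * bx - U 1 * s * bx + pderiv b * (c * pderiv b - s * a))
          - c * U 1 * (c * hx + s * bx) - a * (c * c * hy - s * s * a + c * s * pderiv b)"
      by (simp add: algebra_simps)
    also have "\<dots> = 0"
      unfolding 1 2 hx' hy' by simp
    finally show False
      using a \<open>s \<noteq> 0\<close> by simp
  qed
qed

lemma gradient_zero: "hx = 0 \<and> hy = 0"
  using gradient_zero_if_ax_nonzero hy_zero_if_ax_hx_zero hx_zero_if_ax_zero by blast

end

section \<open>Passage from the Jacobian to the coefficient system, and conclusion\<close>

theorem theorem4p1:
  fixes u v :: "'a::{alg_closed_field, field_char_0} poly3"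
    and h :: "'a poly poly"
  assumes "deg_z v = 1"
    and "eval3 u 0 0 0 = 0" and "eval3 v 0 0 0 = 0" and "eval3 [:h:] 0 0 0 = 0"
    and "deg_z u \<ge> 2"
    and "nilpotent_mat (jacobian3 u v [:h:])"
  shows "lin_dep3 u v [:h:]"
proof -
  define dx :: "'a poly poly \<Rightarrow> 'a poly poly" where "dx = map_poly pderiv"
  obtain a b where v: "v = [:b, a:]" and a: "a \<noteq> 0"
    using assms(1) unfolding deg_z_def by (elim degree1_coeffs)
  let ?J = "jacobian3 u v [:h:]"
  have J: "?J \<in> carrier_mat 3 3"
    by (auto simp: jacobian3_def mat_of_rows_list_def)
  have dxv: "d_x v = [:dx b, dx a:]" and dyv: "d_y v = [:pderiv b, pderiv a:]"
    and dzv: "d_z v = [:a:]"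
    and dxh: "d_x [:h:] = [:dx h:]" and dyh: "d_y [:h:] = [:pderiv h:]" and dzh: "d_z [:h:] = 0"
    by (auto simp: v d_x_def d_y_def d_z_def dx_def map_poly_pCons pderiv_pCons)
  have entries:
    "?J $$ (0,0) = d_x u" "?J $$ (0,1) = d_y u" "?J $$ (0,2) = d_z u"
    "?J $$ (1,0) = d_x v" "?J $$ (1,1) = d_y v" "?J $$ (1,2) = d_z v"
    "?J $$ (2,0) = d_x [:h:]" "?J $$ (2,1) = d_y [:h:]" "?J $$ (2,2) = d_z [:h:]"
    by (simp_all add: jacobian3_def mat_of_rows_list_def)
  have Xu: "coeff (d_x u) n = dx (coeff u n)" and Yu: "coeff (d_y u) n = pderiv (coeff u n)"
    and Zu: "coeff (d_z u) n = of_nat (Suc n) * coeff u (Suc n)" for n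
    by (simp_all add: d_x_def d_y_def d_z_def dx_def coeff_map_poly coeff_pderiv)
  have trace: "d_x u + d_y v = 0"
    using nilpotent_mat_3(1)[OF J assms(6)] unfolding entries dzh by simp
  have minors: "d_x u * d_y v - d_y u * d_x v - d_z u * [:dx h:] - d_z v * [:pderiv h:] = 0"
    using nilpotent_mat_3(2)[OF J assms(6)] unfolding entries dzh dxh dyh by simp
  have det: "[:dx h:] * (d_y u * d_z v - d_z u * d_y v)
      - [:pderiv h:] * (d_x u * d_z v - d_z u * d_x v) = 0"
    using nilpotent_mat_3(3)[OF J assms(6)] unfolding det_3[OF J] entries dzh dxh dyh
    by (simp add: algebra_simps del: mult_pCons_left mult_pCons_right)
  interpret reduced_system "coeff u" "\<lambda>n. dx (coeff u n)" a b "dx a" "dx b"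
    "dx h" "pderiv h" "degree u"
  proof
    show "degree u \<ge> 2"
      using assms(5) by (simp add: deg_z_def)
    then show "coeff u (degree u) \<noteq> 0"
      by auto
    show "coeff u n = 0" if "n > degree u" for n
      using that by (rule coeff_eq_0)
    show "a \<noteq> 0"
      by (rule a)
    \<comment> \<open>Since v is linear in z, the trace equation kills these coefficients from z^2
      on.\<close>
    have X: "dx (coeff u n) = - coeff (d_y v) n" for n
      using arg_cong[OF trace, of "\<lambda>p. coeff p n"] by (simp add: Xu eq_neg_iff_add_eq_0)
    show "dx (coeff u 0) = - pderiv b" "dx (coeff u 1) = - pderiv a"
      unfolding X dyv by simp_all
    show "dx (coeff u n) = 0" if "n \<ge> 2" for n
      using that unfolding X dyv by (simp add: coeff_pCons split: nat.split)
    show "dx (coeff u 0) * pderiv b - pderiv (coeff u 0) * dx b - coeff u 1 * dx h - a * pderiv h = 0"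
      using arg_cong[OF minors, of "\<lambda>p. coeff p 0"] unfolding dxv dyv dzv
      by (simp add: Xu Yu Zu mult_ac)
    show "dx (coeff u (Suc n)) * pderiv b + dx (coeff u n) * pderiv a - pderiv (coeff u (Suc n)) * dx b
        - pderiv (coeff u n) * dx a - of_nat (Suc (Suc n)) * coeff u (Suc (Suc n)) * dx h = 0" for n
      using arg_cong[OF minors, of "\<lambda>p. coeff p (Suc n)"] unfolding dxv dyv dzv
      by (simp add: Xu Yu Zu algebra_simps)
    show "dx h * (pderiv (coeff u n) * a - of_nat (Suc n) * coeff u (Suc n) * pderiv b
          - of_nat n * coeff u n * pderiv a)
        - pderiv h * (dx (coeff u n) * a - of_nat (Suc n) * coeff u (Suc n) * dx b
          - of_nat n * coeff u n * dx a) = 0" for n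
      using arg_cong[OF det, of "\<lambda>p. coeff p n"] unfolding dxv dyv dzv
      by (cases n) (simp_all add: Xu Yu Zu algebra_simps)
  qed
  have "dx h = 0" "pderiv h = 0"
    using gradient_zero by auto
  then obtain g where g: "h = [:g:]"
    by (auto simp: pderiv_eq_0_iff elim: degree_eq_zeroE)
  have "pderiv g = 0"
    using \<open>dx h = 0\<close> by (simp add: g dx_def map_poly_pCons)
  then obtain k where "g = [:k:]"
    by (auto simp: pderiv_eq_0_iff elim: degree_eq_zeroE)
  \<comment> \<open>A zero gradient made h constant, and H(0) = 0 makes that constant 0.\<close>
  then have "h = 0"
    using assms(4) by (simp add: g eval3_def)
  then show ?thesis
    unfolding lin_dep3_def by (intro exI[of _ 0] exI[of _ 1]) (simp add: const3_def)
qed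

end
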